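(* Let $X$ be a complex normed linear space with norm $\|\cdot\|_X$, let $H$ be a nonzero complex Hilbert space, and let $F:X\to L(H)$ be a bounded $L(H)$-valued norm on $X$. Then $F$ preserves Cauchy sequences if and only if $F$ is continuous at $0$ (as a map from $(X,\|\cdot\|_X)$ to $L(H)$ with the operator norm).
   Context: $L(H)$ denotes the bounded linear operators on $H$ with the operator norm $\|T\|=\sup_{\|h\|=1}\|Th\|$, and $S\le T$ means that $T-S$ is a positive operator, where an operator $P$ is positive if $(Ph,h)\ge 0$ for all $h\in H$. An $L(H)$-valued norm on $X$ is a function $F:X\to L(H)$ such that (1) $F(x)\ge 0$ for all $x\in X$; (2) $F(x+y)\le F(x)+F(y)$ for all $x,y\in X$; (3) $F(\lambda x)=|\lambda|F(x)$ for all $\lambda\in\mathbb{C}$, $x\in X$; (4) $F(x)=0$ if and only if $x=0$. $F$ is bounded if $\sup_{\|x\|_X=1}\|F(x)\|<\infty$. $F$ preserves Cauchy sequences if for every Cauchy sequence $\{x_n\}_{n=1}^\infty$ in $(X,\|\cdot\|_X)$, the sequence $\{F(x_n)\}_{n=1}^\infty$ is Cauchy in $L(H)$. *)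

theory Defs
  imports "HOL-Analysis.Analysis"
begin

text \<open>
  Complex vector spaces are built on top of the real classes, so that the library's metric,
  topological and operator-norm notions apply. The compatibility axiom identifies the real
  structure with the restriction of the complex one, so it carries no extra data.
\<close>

class complex_normed_vector = real_normed_vector +
  fixes scaleC :: "complex \<Rightarrow> 'a \<Rightarrow> 'a" (infixr "*\<^sub>C" 75)
  assumes scaleC_add_right: "a *\<^sub>C (x + y) = a *\<^sub>C x + a *\<^sub>C y"
    and scaleC_add_left: "(a + b) *\<^sub>C x = a *\<^sub>C x + b *\<^sub>C x"
    and scaleC_scaleC: "a *\<^sub>C b *\<^sub>C x = (a * b) *\<^sub>C x"
    and scaleC_one: "1 *\<^sub>C x = x"
    and scaleR_scaleC: "r *\<^sub>R x = complex_of_real r *\<^sub>C x"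
    and norm_scaleC: "norm (a *\<^sub>C x) = cmod a * norm x"

text \<open>The inner product is linear in the first argument.\<close>

class complex_hilbert_space = complex_normed_vector + complete_space +
  fixes cinner :: "'a \<Rightarrow> 'a \<Rightarrow> complex"
  assumes cinner_commute: "cinner x y = cnj (cinner y x)"
    and cinner_add_left: "cinner (x + y) z = cinner x z + cinner y z"
    and cinner_scaleC_left: "cinner (a *\<^sub>C x) y = a * cinner x y"
    and cinner_self_norm: "cinner x x = complex_of_real ((norm x)\<^sup>2)"

text \<open>
  The library type of bounded operators consists of the real-linear ones; \<open>L(H)\<close> is its
  subspace of complex-linear operators, with the inherited operator norm.
\<close>

definition bounded_clinear_ops :: "('h::complex_hilbert_space \<Rightarrow>\<^sub>L 'h) set" where
  "bounded_clinear_ops =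
     {T. \<forall>a h. blinfun_apply T (a *\<^sub>C h) = a *\<^sub>C blinfun_apply T h}"

definition positive_op :: "('h::complex_hilbert_space \<Rightarrow>\<^sub>L 'h) \<Rightarrow> bool" where
  "positive_op P \<longleftrightarrow> (\<forall>h. cinner (blinfun_apply P h) h \<in> \<real>\<^sub>\<ge>\<^sub>0)"

definition op_le :: "('h::complex_hilbert_space \<Rightarrow>\<^sub>L 'h) \<Rightarrow> ('h \<Rightarrow>\<^sub>L 'h) \<Rightarrow> bool"
    (infix "\<le>\<^sub>L" 50) where
  "S \<le>\<^sub>L T \<longleftrightarrow> positive_op (T - S)"

definition op_valued_norm ::
    "('x::complex_normed_vector \<Rightarrow> ('h::complex_hilbert_space \<Rightarrow>\<^sub>L 'h)) \<Rightarrow> bool" where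
  "op_valued_norm F \<longleftrightarrow>
     (\<forall>x. F x \<in> bounded_clinear_ops) \<and>
     (\<forall>x. 0 \<le>\<^sub>L F x) \<and>
     (\<forall>x y. F (x + y) \<le>\<^sub>L F x + F y) \<and>
     (\<forall>a x. F (a *\<^sub>C x) = cmod a *\<^sub>R F x) \<and>
     (\<forall>x. F x = 0 \<longleftrightarrow> x = 0)"

definition bounded_on_sphere ::
    "('x::complex_normed_vector \<Rightarrow> ('h::complex_hilbert_space \<Rightarrow>\<^sub>L 'h)) \<Rightarrow> bool" where
  "bounded_on_sphere F \<longleftrightarrow> bdd_above ((\<lambda>x. norm (F x)) ` {x. norm x = 1})"

definition preserves_Cauchy ::
    "('x::complex_normed_vector \<Rightarrow> ('h::complex_hilbert_space \<Rightarrow>\<^sub>L 'h)) \<Rightarrow> bool" where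
  "preserves_Cauchy F \<longleftrightarrow> (\<forall>X. Cauchy X \<longrightarrow> Cauchy (\<lambda>n. F (X n)))"

end

theory Submission
  imports Defs
begin

text \<open>
  Both sides of the equivalence hold for every bounded operator-valued norm, and both follow from
  one estimate. Subadditivity and \<open>F (- z) = F z\<close> give the operator form of the
  reverse triangle inequality, \<open>- F (x - y) \<le> F x - F y \<le> F (x - y)\<close>. The difference
  \<open>F x - F y\<close> has a real quadratic form, so its operator norm is its numerical radius
  (\<open>norm_le_numerical_radius\<close>), and the two-sided order bound becomes a norm bound:
  \<open>\<parallel>F x - F y\<parallel> \<le> \<parallel>F (x - y)\<parallel>\<close> (\<open>op_valued_norm_diff_le\<close>). By homogeneity, boundedness on the
  sphere means \<open>\<parallel>F z\<parallel> \<le> C \<parallel>z\<parallel>\<close> for some \<open>C\<close>. Thus \<open>F\<close> is Lipschitz, and a Lipschitz map is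
  continuous everywhere and preserves Cauchy sequences.
\<close>

lemma scaleC_diff_right:
  fixes x y :: "'a::complex_normed_vector"
  shows "a *\<^sub>C (x - y) = a *\<^sub>C x - a *\<^sub>C y"
  using scaleC_add_right[of a "x - y" y] by (simp add: eq_diff_eq)

lemma cinner_add_right:
  fixes x y z :: "'h::complex_hilbert_space"
  shows "cinner x (y + z) = cinner x y + cinner x z"
  by (metis cinner_add_left cinner_commute complex_cnj_add)

lemma cinner_scaleC_right:
  fixes x y :: "'h::complex_hilbert_space"
  shows "cinner x (a *\<^sub>C y) = cnj a * cinner x y"
  by (metis cinner_commute cinner_scaleC_left complex_cnj_mult)

lemma cinner_scaleR_left:
  fixes x y :: "'h::complex_hilbert_space"
  shows "cinner (r *\<^sub>R x) y = of_real r * cinner x y"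
  by (simp add: scaleR_scaleC cinner_scaleC_left)

lemma cinner_scaleR_right:
  fixes x y :: "'h::complex_hilbert_space"
  shows "cinner x (r *\<^sub>R y) = of_real r * cinner x y"
  by (simp add: scaleR_scaleC cinner_scaleC_right)

lemma cinner_minus_left:
  fixes x y :: "'h::complex_hilbert_space"
  shows "cinner (- x) y = - cinner x y"
  using cinner_scaleR_left[of "-1" x y] by simp

lemma cinner_minus_right:
  fixes x y :: "'h::complex_hilbert_space"
  shows "cinner x (- y) = - cinner x y"
  using cinner_scaleR_right[of x "-1" y] by simp

lemma cinner_diff_left:
  fixes x y z :: "'h::complex_hilbert_space"
  shows "cinner (x - y) z = cinner x z - cinner y z"
  using cinner_add_left[of x "- y" z] by (simp add: cinner_minus_left)

lemma cinner_diff_right: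
  fixes x y z :: "'h::complex_hilbert_space"
  shows "cinner x (y - z) = cinner x y - cinner x z"
  using cinner_add_right[of x y "- z"] by (simp add: cinner_minus_right)

lemma norm_add_squared:
  fixes x y :: "'h::complex_hilbert_space"
  shows "(norm (x + y))\<^sup>2 = (norm x)\<^sup>2 + 2 * Re (cinner x y) + (norm y)\<^sup>2"
proof -
  have "(norm (x + y))\<^sup>2 = Re (cinner (x + y) (x + y))"
    by (simp only: cinner_self_norm Re_complex_of_real)
  also have "\<dots> = Re (cinner x x) + Re (cinner x y) + Re (cinner y x) + Re (cinner y y)"
    by (simp add: cinner_add_left cinner_add_right)
  also have "Re (cinner y x) = Re (cinner x y)"
    by (metis cinner_commute complex_cnj cnj.sel(1))
  finally show ?thesis
    by (simp only: cinner_self_norm Re_complex_of_real)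
qed

lemma parallelogram_law:
  fixes x y :: "'h::complex_hilbert_space"
  shows "(norm (x + y))\<^sup>2 + (norm (x - y))\<^sup>2 = 2 * (norm x)\<^sup>2 + 2 * (norm y)\<^sup>2"
  using norm_add_squared[of x y] norm_add_squared[of x "- y"]
  by (simp add: cinner_minus_right)

text \<open>
  Since the norm is already known to satisfy the triangle inequality, Cauchy--Schwarz is just that
  inequality squared.
\<close>

lemma Re_cinner_le_norm:
  fixes x y :: "'h::complex_hilbert_space"
  shows "Re (cinner x y) \<le> norm x * norm y"
proof -
  have "(norm (x + y))\<^sup>2 \<le> (norm x + norm y)\<^sup>2"
    by (intro power_mono norm_triangle_ineq) simp
  then show ?thesis
    by (simp add: norm_add_squared power2_sum)
qed

text \<open>
  A complex-linear operator with a real quadratic form is symmetric: the quadratic form at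
  \<open>x + \<i> y\<close> and at \<open>x\<close>, \<open>y\<close> is real, and its cross term has imaginary part
  \<open>Re (A y, x) - Re (A x, y)\<close>.
\<close>

lemma Re_cinner_symmetric:
  fixes A :: "'h::complex_hilbert_space \<Rightarrow>\<^sub>L 'h"
  assumes lin: "A \<in> bounded_clinear_ops"
    and real: "\<And>h. cinner (A h) h \<in> \<real>"
  shows "Re (cinner (A y) x) = Re (cinner (A x) y)"
proof -
  have "Im (cinner (A (x + \<i> *\<^sub>C y)) (x + \<i> *\<^sub>C y)) = 0"
    using real by (simp add: complex_is_Real_iff)
  moreover have "A (\<i> *\<^sub>C y) = \<i> *\<^sub>C A y"
    using lin by (simp add: bounded_clinear_ops_def)
  moreover have "Im (cinner (A x) x) = 0" "Im (cinner (A y) y) = 0"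
    using real by (simp_all add: complex_is_Real_iff)
  ultimately show ?thesis
    by (simp add: blinfun.add_right cinner_add_left cinner_add_right
        cinner_scaleC_left cinner_scaleC_right)
qed

text \<open>
  Polarisation bounds the symmetric form of \<open>A\<close> by its quadratic form, and the parallelogram law
  turns this into \<open>2 Re (A x, y) \<le> w (\<parallel>x\<parallel>\<^sup>2 + \<parallel>y\<parallel>\<^sup>2)\<close>. Choosing \<open>y\<close> in the direction of \<open>A x\<close>
  with the length of \<open>x\<close> yields \<open>\<parallel>A x\<parallel> \<le> w \<parallel>x\<parallel>\<close>.
\<close>

lemma norm_le_numerical_radius:
  fixes A :: "'h::complex_hilbert_space \<Rightarrow>\<^sub>L 'h"
  assumes lin: "A \<in> bounded_clinear_ops"
    and real: "\<And>h. cinner (A h) h \<in> \<real>"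
    and bound: "\<And>h. \<bar>Re (cinner (A h) h)\<bar> \<le> w * (norm h)\<^sup>2"
    and "0 \<le> w"
  shows "norm A \<le> w"
proof (rule norm_blinfun_bound[OF \<open>0 \<le> w\<close>])
  fix x
  have polar: "2 * Re (cinner (A x) y) \<le> w * ((norm x)\<^sup>2 + (norm y)\<^sup>2)" for y
  proof -
    have "4 * Re (cinner (A x) y)
        = Re (cinner (A (x + y)) (x + y)) - Re (cinner (A (x - y)) (x - y))"
      using Re_cinner_symmetric[OF lin real, of y x]
      by (simp add: blinfun.add_right blinfun.diff_right cinner_add_left cinner_add_right
          cinner_diff_left cinner_diff_right)
    also have "\<dots> \<le> w * (norm (x + y))\<^sup>2 + w * (norm (x - y))\<^sup>2"
      using bound[of "x + y"] bound[of "x - y"] by linarith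
    also have "\<dots> = w * (2 * (norm x)\<^sup>2 + 2 * (norm y)\<^sup>2)"
      by (simp only: parallelogram_law flip: distrib_left)
    finally show ?thesis by (simp add: algebra_simps)
  qed
  show "norm (A x) \<le> w * norm x"
  proof (cases "A x = 0 \<or> x = 0")
    case True
    then show ?thesis using \<open>0 \<le> w\<close> by (auto simp: blinfun.zero_right)
  next
    case False
    define y where "y = (norm x / norm (A x)) *\<^sub>R A x"
    have "norm y = norm x"
      using False by (simp add: y_def)
    moreover have "Re (cinner (A x) y) = norm x * norm (A x)"
      using False by (simp add: y_def cinner_scaleR_right cinner_self_norm power2_eq_square)
    ultimately have "norm x * norm (A x) \<le> norm x * (w * norm x)"
      using polar[of y] by (simp add: power2_eq_square algebra_simps)
    then show ?thesis using False by simp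
  qed
qed

lemma op_leD:
  assumes "S \<le>\<^sub>L T"
  shows "cinner (T h) h - cinner (S h) h \<in> \<real>\<^sub>\<ge>\<^sub>0"
  using assms unfolding op_le_def positive_op_def
  by (metis blinfun.diff_left cinner_diff_left)

lemma op_valued_norm_minus:
  assumes "op_valued_norm F"
  shows "F (- x) = F x"
proof -
  have "F ((- 1) *\<^sub>C x) = cmod (- 1) *\<^sub>R F x"
    using assms unfolding op_valued_norm_def by blast
  moreover have "(- 1) *\<^sub>C x = - x"
    using scaleR_scaleC[of "-1" x] by simp
  ultimately show ?thesis by simp
qed

text \<open>
  The reverse triangle inequality holds for the quadratic forms at each vector \<open>h\<close>; as
  \<open>F x - F y\<close> has a real quadratic form, these bounds control its operator norm.
\<close>

lemma op_valued_norm_diff_le: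
  assumes F: "op_valued_norm F"
  shows "norm (F x - F y) \<le> norm (F (x - y))"
proof (rule norm_le_numerical_radius)
  show "F x - F y \<in> bounded_clinear_ops"
    using F by (simp add: op_valued_norm_def bounded_clinear_ops_def blinfun.diff_left
        scaleC_diff_right)
next
  have pos: "cinner (F z h) h \<in> \<real>\<^sub>\<ge>\<^sub>0" for z h
    using F op_leD[of 0 "F z" h] cinner_scaleR_left[of 0 h h]
    by (simp add: op_valued_norm_def)
  fix h
  show "cinner ((F x - F y) h) h \<in> \<real>"
    using pos[of x h] pos[of y h]
    by (simp add: blinfun.diff_left cinner_diff_left complex_nonneg_Reals_iff complex_is_Real_iff)
  have tri: "Re (cinner (F u h) h) \<le> Re (cinner (F (u - v) h) h) + Re (cinner (F v h) h)" for u v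
  proof -
    have "F ((u - v) + v) \<le>\<^sub>L F (u - v) + F v"
      using F unfolding op_valued_norm_def by blast
    from op_leD[OF this, of h] show ?thesis
      by (simp add: blinfun.add_left cinner_add_left complex_nonneg_Reals_iff)
  qed
  have "F (y - x) = F (x - y)"
    using op_valued_norm_minus[OF F, of "x - y"] by simp
  then have "\<bar>Re (cinner ((F x - F y) h) h)\<bar> \<le> Re (cinner (F (x - y) h) h)"
    using tri[of x y] tri[of y x] by (simp add: blinfun.diff_left cinner_diff_left)
  also have "\<dots> \<le> norm (F (x - y) h) * norm h"
    by (rule Re_cinner_le_norm)
  also have "\<dots> \<le> norm (F (x - y)) * norm h * norm h"
    by (intro mult_right_mono norm_blinfun) simp
  finally show "\<bar>Re (cinner ((F x - F y) h) h)\<bar> \<le> norm (F (x - y)) * (norm h)\<^sup>2"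
    by (simp add: power2_eq_square mult.assoc)
qed simp

lemma op_valued_norm_scaleR:
  assumes "op_valued_norm F"
  shows "F (r *\<^sub>R x) = \<bar>r\<bar> *\<^sub>R F x"
  using assms by (simp add: op_valued_norm_def scaleR_scaleC norm_of_real)

lemma bounded_on_sphere_imp_linear_bound:
  assumes F: "op_valued_norm F" and "bounded_on_sphere F"
  obtains C where "0 \<le> C" "\<And>x. norm (F x) \<le> C * norm x"
proof -
  obtain M where M: "\<And>x. norm x = 1 \<Longrightarrow> norm (F x) \<le> M"
    using assms(2) by (auto simp: bounded_on_sphere_def bdd_above_def)
  \<comment> \<open>The unit sphere of the zero space is empty, so \<open>M\<close> itself may be negative.\<close>
  have "norm (F x) \<le> max M 0 * norm x" for x
  proof (cases "x = 0")
    case True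
    then show ?thesis using F by (simp add: op_valued_norm_def)
  next
    case False
    have "norm (F x) = norm x * norm (F (x /\<^sub>R norm x))"
      using False by (simp add: op_valued_norm_scaleR[OF F])
    also have "\<dots> \<le> norm x * max M 0"
      using M[of "x /\<^sub>R norm x"] False by (intro mult_left_mono) auto
    finally show ?thesis by (simp add: mult.commute)
  qed
  then show thesis by (intro that[of "max M 0"]) auto
qed

lemma bounded_op_valued_norm_lipschitz:
  assumes "op_valued_norm F" and "bounded_on_sphere F"
  obtains C where "C-lipschitz_on UNIV F"
proof -
  obtain C where C: "0 \<le> C" "\<And>x. norm (F x) \<le> C * norm x"
    using bounded_on_sphere_imp_linear_bound[OF assms] by blast
  have "C-lipschitz_on UNIV F"
  proof (rule lipschitz_onI)
    fix x y
    show "dist (F x) (F y) \<le> C * dist x y"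
      using op_valued_norm_diff_le[OF assms(1), of x y] C(2)[of "x - y"] by (simp add: dist_norm)
  qed (rule C(1))
  then show thesis by (rule that)
qed

theorem theorem1p6:
  fixes F :: "'x::complex_normed_vector \<Rightarrow> ('h::complex_hilbert_space \<Rightarrow>\<^sub>L 'h)"
  assumes "\<exists>h::'h. h \<noteq> 0"
    and "op_valued_norm F"
    and "bounded_on_sphere F"
  shows "preserves_Cauchy F \<longleftrightarrow> isCont F 0"
proof -
  obtain C where "C-lipschitz_on UNIV F"
    using bounded_op_valued_norm_lipschitz[OF assms(2,3)] .
  then have uc: "uniformly_continuous_on UNIV F"
    by (rule lipschitz_on_uniformly_continuous)
  then have "preserves_Cauchy F"
    unfolding preserves_Cauchy_def
    by (auto intro: uniformly_continuous_on_Cauchy)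
  moreover have "isCont F 0"
    using uniformly_continuous_imp_continuous[OF uc] by (simp add: continuous_on_eq_continuous_at)
  ultimately show ?thesis by blast
qed

end
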